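(* Let $\mathscr{U}$ be a $p$-point and let $\mathbb{P}$ be a proper, $\omega^\omega$-bounding forcing notion which preserves $p$-points. Let $\mathscr{I}$ be a $\mathscr{U}$-encompassing maximal ideal independent family such that for every $A\in\mathscr{I}$ the complemented filter $\mathcal{F}(\mathscr{I},A)$ is a $p$-point. Then $\mathscr{I}$ remains a maximal ideal independent family in every generic extension by $\mathbb{P}$.
   Context: For $A,B\subseteq\omega$, $A\subseteq^* B$ means $A\setminus B$ is finite. A family $\mathscr{I}\subseteq[\omega]^\omega$ is ideal independent if whenever $X_0,\dots,X_{n-1},A\in\mathscr{I}$ and $A\subseteq^*\bigcup_{i<n}X_i$, then $X_i=A$ for some $i<n$; it is maximal ideal independent if it is maximal under inclusion among ideal independent families. For $A\in\mathscr{I}$, the complemented filter $\mathcal{F}(\mathscr{I},A)$ is the filter on $\omega$ generated by $\{A\setminus\bigcup F:F\in[\mathscr{I}]^{<\omega},\ A\notin F\}$. A $p$-point is a non-principal ultrafilter $\mathscr{U}$ on $\omega$ such that every countable subfamily of $\mathscr{U}$ has a pseudo-intersection in $\mathscr{U}$. A forcing preserves $p$-points if every $p$-point of the ground model generates an ultrafilter in the extension. For an ultrafilter $\mathscr{U}$, a maximal ideal independent family $\mathscr{I}$ is $\mathscr{U}$-encompassing if (1) $\mathscr{U}\cap\mathscr{I}=\emptyset$, and (2) for every $X\in\mathscr{U}$ the set $\{A\in\mathscr{I}: X\in\mathcal{F}(\mathscr{I},A)\}$ is co-countable in $\mathscr{I}$. *)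

theory Defs
  imports "HOL-Library.Countable_Set"
begin

section \<open>Families of sets of natural numbers\<close>

definition almost_subset :: "nat set \<Rightarrow> nat set \<Rightarrow> bool"  (infix "\<subseteq>\<^sup>*" 50)
  where "A \<subseteq>\<^sup>* B \<longleftrightarrow> finite (A - B)"

definition ideal_independent :: "nat set set \<Rightarrow> bool"
  where "ideal_independent \<I> \<longleftrightarrow>
    (\<forall>X\<in>\<I>. infinite X) \<and>
    (\<forall>(n::nat) X A. (\<forall>i<n. X i \<in> \<I>) \<and> A \<in> \<I> \<and> A \<subseteq>\<^sup>* (\<Union>i<n. X i) \<longrightarrow> (\<exists>i<n. X i = A))"

definition maximal_ideal_independent :: "nat set set \<Rightarrow> bool"
  where "maximal_ideal_independent \<I> \<longleftrightarrow>
    ideal_independent \<I> \<and> (\<forall>\<J>. ideal_independent \<J> \<and> \<I> \<subseteq> \<J> \<longrightarrow> \<J> = \<I>)"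

definition generated_filter :: "nat set set \<Rightarrow> nat set set"
  where "generated_filter \<B> = {Y. \<exists>F. finite F \<and> F \<subseteq> \<B> \<and> \<Inter>F \<subseteq> Y}"

definition complemented_filter :: "nat set set \<Rightarrow> nat set \<Rightarrow> nat set set"
  where "complemented_filter \<I> A =
    generated_filter {A - \<Union>F | F. finite F \<and> F \<subseteq> \<I> \<and> A \<notin> F}"

definition ultrafilter_on_nat :: "nat set set \<Rightarrow> bool"
  where "ultrafilter_on_nat \<U> \<longleftrightarrow>
    UNIV \<in> \<U> \<and> {} \<notin> \<U> \<and>
    (\<forall>X\<in>\<U>. \<forall>Y\<in>\<U>. X \<inter> Y \<in> \<U>) \<and>
    (\<forall>X\<in>\<U>. \<forall>Y. X \<subseteq> Y \<longrightarrow> Y \<in> \<U>) \<and>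
    (\<forall>X. X \<in> \<U> \<or> - X \<in> \<U>)"

definition p_point :: "nat set set \<Rightarrow> bool"
  where "p_point \<U> \<longleftrightarrow>
    ultrafilter_on_nat \<U> \<and>
    \<not> (\<exists>k. \<U> = {X. k \<in> X}) \<and>
    (\<forall>\<C>. \<C> \<subseteq> \<U> \<and> countable \<C> \<longrightarrow> (\<exists>Y\<in>\<U>. \<forall>X\<in>\<C>. Y \<subseteq>\<^sup>* X))"

definition encompassing :: "nat set set \<Rightarrow> nat set set \<Rightarrow> bool"
  where "encompassing \<U> \<I> \<longleftrightarrow>
    \<U> \<inter> \<I> = {} \<and>
    (\<forall>X\<in>\<U>. countable (\<I> - {A \<in> \<I>. X \<in> complemented_filter \<I> A}))"


text \<open>
  \<open>S\<close> is a stationary set of countable subsets of \<open>X\<close>: for every function from the finite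
  sequences in \<open>X\<close> to \<open>X\<close>, some member of \<open>S\<close> is closed under it. (A single such function codes
  countably many finitary operations.)
\<close>

definition stationary :: "'x set \<Rightarrow> 'x set set \<Rightarrow> bool"
  where "stationary X S \<longleftrightarrow>
    (\<forall>a\<in>S. a \<subseteq> X \<and> countable a) \<and>
    (\<forall>F. (\<forall>s\<in>lists X. F s \<in> X) \<longrightarrow> (\<exists>a\<in>S. \<forall>s\<in>lists a. F s \<in> a))"


section \<open>The forcing relation\<close>

text \<open>
  A forcing notion is a nonempty preorder, given as a relation \<open>P\<close>; its set of conditions is
  \<open>Field P\<close>, and \<open>(q, p) \<in> P\<close> means that \<open>q\<close> is stronger than \<open>p\<close>. A greatest condition is not
  required, so ``every generic extension satisfies \<open>\<phi>\<close>'' is ``every condition forces \<open>\<phi>\<close>''.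

  A statement \<open>\<phi>\<close> about the extension is represented by the set of conditions forcing it,
  \<open>\<phi> p\<close> being \<open>p \<tturnstile> \<phi>\<close>. The clauses below are the usual recursive clauses of the forcing
  relation. \<open>fall A\<close> and \<open>fex A\<close> quantify over the elements of a ground-model set \<open>A\<close>, and,
  with \<open>A = UNIV\<close> at a type of names, over the objects of the extension named by that type.

  Two levels of names are needed. A name of a subset of (the check name of) a ground-model set is
  a set of pairs \<open>(x, s)\<close>, standing for the \<open>P\<close>-name consisting of the pairs of the check name of
  \<open>x\<close> and \<open>s\<close>; every subset of a ground-model set in the extension has such a nice name. A name of
  a family of such subsets is a set of pairs \<open>(\<rho>, s)\<close> with \<open>\<rho>\<close> a name of the first level. Pairs whose
  second component is not a condition have no effect. In the extension, a
  sequence of subsets of a ground-model set \<open>X\<close> is coded by a subset of \<open>\<omega> \<times> X\<close>, so it is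
  given by a ground-model sequence of names.
\<close>

definition forcing_notion :: "'p rel \<Rightarrow> bool"
  where "forcing_notion P \<longleftrightarrow> Preorder P \<and> P \<noteq> {}"

type_synonym ('x, 'p) set_name = "('x \<times> 'p) set"
type_synonym ('x, 'p) family_name = "(('x, 'p) set_name \<times> 'p) set"

definition fconst :: "bool \<Rightarrow> 'p \<Rightarrow> bool"
  where "fconst b p \<longleftrightarrow> b"

definition fconj :: "('p \<Rightarrow> bool) \<Rightarrow> ('p \<Rightarrow> bool) \<Rightarrow> 'p \<Rightarrow> bool"  (infixr "\<^bold>\<and>" 35)
  where "(\<phi> \<^bold>\<and> \<psi>) p \<longleftrightarrow> \<phi> p \<and> \<psi> p"

definition fall :: "'x set \<Rightarrow> ('x \<Rightarrow> 'p \<Rightarrow> bool) \<Rightarrow> 'p \<Rightarrow> bool"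
  where "fall A \<Phi> p \<longleftrightarrow> (\<forall>x\<in>A. \<Phi> x p)"

context
  fixes P :: "'p rel"
begin

definition fneg :: "('p \<Rightarrow> bool) \<Rightarrow> 'p \<Rightarrow> bool"  ("\<^bold>\<not> _" [40] 40)
  where "(\<^bold>\<not> \<phi>) p \<longleftrightarrow> (\<forall>q. (q, p) \<in> P \<longrightarrow> \<not> \<phi> q)"

definition dense_below :: "('p \<Rightarrow> bool) \<Rightarrow> 'p \<Rightarrow> bool"
  where "dense_below D p \<longleftrightarrow> (\<forall>q. (q, p) \<in> P \<longrightarrow> (\<exists>r. (r, q) \<in> P \<and> D r))"

definition fdisj :: "('p \<Rightarrow> bool) \<Rightarrow> ('p \<Rightarrow> bool) \<Rightarrow> 'p \<Rightarrow> bool"  (infixr "\<^bold>\<or>" 30)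
  where "(\<phi> \<^bold>\<or> \<psi>) = dense_below (\<lambda>r. \<phi> r \<or> \<psi> r)"

definition fimp :: "('p \<Rightarrow> bool) \<Rightarrow> ('p \<Rightarrow> bool) \<Rightarrow> 'p \<Rightarrow> bool"  (infixr "\<^bold>\<longrightarrow>" 25)
  where "(\<phi> \<^bold>\<longrightarrow> \<psi>) p \<longleftrightarrow> (\<forall>q. (q, p) \<in> P \<and> \<phi> q \<longrightarrow> \<psi> q)"

definition fiff :: "('p \<Rightarrow> bool) \<Rightarrow> ('p \<Rightarrow> bool) \<Rightarrow> 'p \<Rightarrow> bool"  (infixr "\<^bold>\<longleftrightarrow>" 25)
  where "(\<phi> \<^bold>\<longleftrightarrow> \<psi>) = ((\<phi> \<^bold>\<longrightarrow> \<psi>) \<^bold>\<and> (\<psi> \<^bold>\<longrightarrow> \<phi>))"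

definition fex :: "'x set \<Rightarrow> ('x \<Rightarrow> 'p \<Rightarrow> bool) \<Rightarrow> 'p \<Rightarrow> bool"
  where "fex A \<Phi> = dense_below (\<lambda>r. \<exists>x\<in>A. \<Phi> x r)"

definition fmem :: "'x \<Rightarrow> ('x, 'p) set_name \<Rightarrow> 'p \<Rightarrow> bool"  (infix "\<^bold>\<in>" 50)
  where "(x \<^bold>\<in> \<tau>) = dense_below (\<lambda>r. \<exists>s. (x, s) \<in> \<tau> \<and> (r, s) \<in> P)"

definition feq :: "('x, 'p) set_name \<Rightarrow> ('x, 'p) set_name \<Rightarrow> 'p \<Rightarrow> bool"  (infix "\<^bold>=" 50)
  where "(\<tau> \<^bold>= \<rho>) = fall UNIV (\<lambda>x. x \<^bold>\<in> \<tau> \<^bold>\<longleftrightarrow> x \<^bold>\<in> \<rho>)"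

definition fMem :: "('x, 'p) set_name \<Rightarrow> ('x, 'p) family_name \<Rightarrow> 'p \<Rightarrow> bool"
    (infix "\<^bold>\<in>\<^bold>\<in>" 50)
  where "(\<tau> \<^bold>\<in>\<^bold>\<in> \<sigma>) = dense_below (\<lambda>r. \<exists>\<rho> s. (\<rho>, s) \<in> \<sigma> \<and> (r, s) \<in> P \<and> (\<tau> \<^bold>= \<rho>) r)"

definition check :: "'x set \<Rightarrow> ('x, 'p) set_name"
  where "check A = A \<times> Field P"

definition check_family :: "'x set set \<Rightarrow> ('x, 'p) family_name"
  where "check_family \<A> = check ` \<A> \<times> Field P"

definition forced :: "('p \<Rightarrow> bool) \<Rightarrow> bool"
  where "forced \<phi> \<longleftrightarrow> (\<forall>p\<in>Field P. \<phi> p)"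


section \<open>Properties of forcing notions\<close>

definition f_function :: "'a set \<Rightarrow> 'b set \<Rightarrow> ('a \<times> 'b, 'p) set_name \<Rightarrow> 'p \<Rightarrow> bool"
  where "f_function A B f =
    (fall UNIV (\<lambda>(a, b). (a, b) \<^bold>\<in> f \<^bold>\<longrightarrow> fconst (a \<in> A \<and> b \<in> B)) \<^bold>\<and>
     fall A (\<lambda>a. fex B (\<lambda>b. (a, b) \<^bold>\<in> f)) \<^bold>\<and>
     fall A (\<lambda>a. fall B (\<lambda>b. fall B (\<lambda>c.
       (a, b) \<^bold>\<in> f \<^bold>\<and> (a, c) \<^bold>\<in> f \<^bold>\<longrightarrow> fconst (b = c)))))"

definition omega_omega_bounding :: bool
  where "omega_omega_bounding \<longleftrightarrow> forced
    (fall UNIV (\<lambda>f :: (nat \<times> nat, 'p) set_name.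
      f_function UNIV UNIV f \<^bold>\<longrightarrow>
      fex UNIV (\<lambda>g :: nat \<Rightarrow> nat. fall UNIV (\<lambda>n. fall UNIV (\<lambda>m.
        (n, m) \<^bold>\<in> f \<^bold>\<longrightarrow> fconst (m \<le> g n))))))"

text \<open>
  The filter generated by a family is closed under supersets and finite intersections by
  construction, so that only properness and maximality remain to be stated.
\<close>

definition f_generated_filter :: "(nat, 'p) family_name \<Rightarrow> (nat, 'p) set_name \<Rightarrow> 'p \<Rightarrow> bool"
  where "f_generated_filter \<sigma> Y =
    fex UNIV (\<lambda>n :: nat. fex UNIV (\<lambda>X :: nat \<Rightarrow> (nat, 'p) set_name.
      fall {..<n} (\<lambda>i. X i \<^bold>\<in>\<^bold>\<in> \<sigma>) \<^bold>\<and>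
      fall UNIV (\<lambda>k. fall {..<n} (\<lambda>i. k \<^bold>\<in> X i) \<^bold>\<longrightarrow> k \<^bold>\<in> Y)))"

definition f_generates_ultrafilter :: "(nat, 'p) family_name \<Rightarrow> 'p \<Rightarrow> bool"
  where "f_generates_ultrafilter \<sigma> =
    (fall UNIV (\<lambda>Y. f_generated_filter \<sigma> Y \<^bold>\<longrightarrow> fex UNIV (\<lambda>k. k \<^bold>\<in> Y)) \<^bold>\<and>
     fall UNIV (\<lambda>Y. fall UNIV (\<lambda>Z.
       fall UNIV (\<lambda>k. k \<^bold>\<in> Z \<^bold>\<longleftrightarrow> \<^bold>\<not> k \<^bold>\<in> Y) \<^bold>\<longrightarrow>
       f_generated_filter \<sigma> Y \<^bold>\<or> f_generated_filter \<sigma> Z)))"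

definition preserves_p_points :: bool
  where "preserves_p_points \<longleftrightarrow>
    (\<forall>\<U>. p_point \<U> \<longrightarrow> forced (f_generates_ultrafilter (check_family \<U>)))"

text \<open>
  Stationarity in the extension. Finite sequences of elements of a ground-model set belong to the
  ground model, and members of a ground-model set of countable sets stay countable, so that
  countability is not restated.
\<close>

definition f_stationary :: "'x set \<Rightarrow> ('x, 'p) family_name \<Rightarrow> 'p \<Rightarrow> bool"
  where "f_stationary X \<sigma> =
    fall UNIV (\<lambda>F :: ('x list \<times> 'x, 'p) set_name.
      f_function (lists X) X F \<^bold>\<longrightarrow>
      fex UNIV (\<lambda>a. a \<^bold>\<in>\<^bold>\<in> \<sigma> \<^bold>\<and>
        fall (lists X) (\<lambda>s. fall X (\<lambda>y.
          fall (set s) (\<lambda>x. x \<^bold>\<in> a) \<^bold>\<and> (s, y) \<^bold>\<in> F \<^bold>\<longrightarrow> y \<^bold>\<in> a))))"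

text \<open>
  Shelah's definition of properness: every stationary set of countable subsets of a ground-model
  set \<open>X\<close> remains stationary. (For countable \<open>X\<close> this holds for every forcing notion.)

  A definition in HOL cannot range over all cardinals \<open>\<lambda> = card X\<close>; here \<open>X\<close> ranges over
  all sets of sets of conditions, so that \<open>\<lambda> \<le> 2 ^ card P\<close>. This is implied by the requirement for
  all \<open>\<lambda>\<close>, and it is equivalent to it: whether a condition is \<open>(M, P)\<close>-generic, for a countable
  elementary submodel \<open>M\<close>, depends only on the conditions and the sets of conditions that belong
  to \<open>M\<close>.
\<close>

definition proper :: bool
  where "proper \<longleftrightarrow>
    (\<forall>(X :: 'p set set) S. stationary X S \<longrightarrow> forced (f_stationary X (check_family S)))"


section \<open>Maximal ideal independence in the extension\<close>

text \<open>A set of natural numbers is finite iff it is bounded.\<close>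

definition f_infinite :: "(nat, 'p) set_name \<Rightarrow> 'p \<Rightarrow> bool"
  where "f_infinite X = fall UNIV (\<lambda>m :: nat. fex {m..} (\<lambda>k. k \<^bold>\<in> X))"

definition f_almost_covered ::
    "(nat, 'p) set_name \<Rightarrow> nat \<Rightarrow> (nat \<Rightarrow> (nat, 'p) set_name) \<Rightarrow> 'p \<Rightarrow> bool"
  where "f_almost_covered A n X =
    fex UNIV (\<lambda>m. fall {m..} (\<lambda>k. k \<^bold>\<in> A \<^bold>\<longrightarrow> fex {..<n} (\<lambda>i. k \<^bold>\<in> X i)))"

definition f_ideal_independent :: "(nat, 'p) family_name \<Rightarrow> 'p \<Rightarrow> bool"
  where "f_ideal_independent \<sigma> =
    (fall UNIV (\<lambda>X. X \<^bold>\<in>\<^bold>\<in> \<sigma> \<^bold>\<longrightarrow> f_infinite X) \<^bold>\<and>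
     fall UNIV (\<lambda>n :: nat. fall UNIV (\<lambda>X :: nat \<Rightarrow> (nat, 'p) set_name. fall UNIV (\<lambda>A.
       fall {..<n} (\<lambda>i. X i \<^bold>\<in>\<^bold>\<in> \<sigma>) \<^bold>\<and> A \<^bold>\<in>\<^bold>\<in> \<sigma> \<^bold>\<and> f_almost_covered A n X \<^bold>\<longrightarrow>
       fex {..<n} (\<lambda>i. X i \<^bold>= A)))))"

definition f_maximal_ideal_independent :: "(nat, 'p) family_name \<Rightarrow> 'p \<Rightarrow> bool"
  where "f_maximal_ideal_independent \<sigma> =
    (f_ideal_independent \<sigma> \<^bold>\<and>
     fall UNIV (\<lambda>\<tau>.
       f_ideal_independent \<tau> \<^bold>\<and> fall UNIV (\<lambda>X. X \<^bold>\<in>\<^bold>\<in> \<sigma> \<^bold>\<longrightarrow> X \<^bold>\<in>\<^bold>\<in> \<tau>) \<^bold>\<longrightarrow>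
       fall UNIV (\<lambda>X. X \<^bold>\<in>\<^bold>\<in> \<tau> \<^bold>\<longleftrightarrow> X \<^bold>\<in>\<^bold>\<in> \<sigma>)))"

end

end

theory Submission
  imports Defs
begin

text \<open>
  Let \<open>Y\<close> be a set in the extension which can be added to \<open>\<I>\<close>. By preservation of \<open>p\<close>-points the
  filter \<open>\<F>(\<I>, A)\<close> decides \<open>Y\<close> for every \<open>A \<in> \<I>\<close>. If it contains \<open>Y\<close>, then \<open>A\<close> is covered by
  \<open>Y\<close> and finitely many other members of \<open>\<I>\<close>, so \<open>Y \<in> \<I>\<close>. Otherwise all these filters
  contain the complement of \<open>Y\<close>. Then \<open>\<U>\<close> contains some \<open>X\<close> disjoint from \<open>Y\<close>, which belongs to
  \<open>\<F>(\<I>, A)\<close> for all \<open>A \<in> \<I>\<close> but countably many \<open>A\<^sub>n\<close> (for countable \<open>\<I>\<close> take \<open>X = {}\<close>).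
  For each \<open>n\<close> some finite \<open>F\<^sub>n\<close> has \<open>A\<^sub>n - \<Union>F\<^sub>n\<close> disjoint from \<open>Y\<close>; as the forcing is proper
  and \<open>\<omega>\<^sup>\<omega>\<close>-bounding, each \<open>F\<^sub>n\<close> is one of finitely many candidates listed in the ground model, and
  replacing \<open>F\<^sub>n\<close> by the union of the candidates yields a ground-model sequence. Now
  \<open>C = \<omega> - (X \<union> (\<Union>n. A\<^sub>n - \<Union>F\<^sub>n))\<close> is a ground-model set containing \<open>Y\<close> and belonging to no
  \<open>\<F>(\<I>, A)\<close>, so by maximality of \<open>\<I>\<close> it is almost covered by finitely many members of \<open>\<I>\<close>,
  and hence so is \<open>Y\<close>.
\<close>

section \<open>Ultrafilters and p-points in the ground model\<close>

lemma ultrafilter_mono: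
  "ultrafilter_on_nat \<U> \<Longrightarrow> X \<in> \<U> \<Longrightarrow> X \<subseteq> Y \<Longrightarrow> Y \<in> \<U>"
  by (simp add: ultrafilter_on_nat_def)

lemma ultrafilter_Int:
  "ultrafilter_on_nat \<U> \<Longrightarrow> X \<in> \<U> \<Longrightarrow> Y \<in> \<U> \<Longrightarrow> X \<inter> Y \<in> \<U>"
  by (simp add: ultrafilter_on_nat_def)

lemma Inter_mem_ultrafilter:
  assumes "ultrafilter_on_nat \<U>" and "finite F" and "F \<subseteq> \<U>"
  shows "\<Inter>F \<in> \<U>"
  using assms(2,3)
proof (induction rule: finite_induct)
  case empty
  then show ?case using assms(1) by (simp add: ultrafilter_on_nat_def)
next
  case (insert X F)
  then have "X \<in> \<U>" "\<Inter>F \<in> \<U>" by auto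
  then have "X \<inter> \<Inter>F \<in> \<U>" by (rule ultrafilter_Int[OF assms(1)])
  then show ?case by simp
qed

text \<open>An ultrafilter containing \<open>{k}\<close> is the principal one at \<open>k\<close>,
  so \<open>\<U>\<close> contains every \<open>- {k}\<close> and hence their finite
  intersections.\<close>

lemma cofinite_mem_p_point:
  assumes "p_point \<U>" and "finite F"
  shows "- F \<in> \<U>"
proof -
  have u: "ultrafilter_on_nat \<U>" and np: "\<And>k. \<U> \<noteq> {X. k \<in> X}"
    using assms(1) by (auto simp: p_point_def)
  have "- {k} \<in> \<U>" for k
  proof (rule ccontr)
    assume "- {k} \<notin> \<U>"
    then have k: "{k} \<in> \<U>" using u unfolding ultrafilter_on_nat_def by blast
    have "X \<in> \<U> \<longleftrightarrow> k \<in> X" for X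
    proof
      assume "X \<in> \<U>"
      then have "X \<inter> {k} \<in> \<U>" using k u unfolding ultrafilter_on_nat_def by blast
      moreover have "{} \<notin> \<U>" using u unfolding ultrafilter_on_nat_def by blast
      ultimately show "k \<in> X" by (cases "k \<in> X") auto
    next
      assume "k \<in> X"
      then show "X \<in> \<U>" using k u unfolding ultrafilter_on_nat_def by blast
    qed
    then show False using np by blast
  qed
  then have "\<Inter>((\<lambda>k. - {k}) ` F) \<in> \<U>"
    using assms(2) by (intro Inter_mem_ultrafilter[OF u]) auto
  moreover have "\<Inter>((\<lambda>k. - {k}) ` F) = - F" by auto
  ultimately show ?thesis by simp
qed


section \<open>Complemented filters and maximality in the ground model\<close>

lemma complemented_filterI:
  assumes "finite F" "F \<subseteq> \<I>" "A \<notin> F" "A - \<Union>F \<subseteq> Y"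
  shows "Y \<in> complemented_filter \<I> A"
  unfolding complemented_filter_def generated_filter_def
  using assms by (intro CollectI exI[of _ "{A - \<Union>F}"]) auto

text \<open>One generator suffices, since the intersection of \<open>A - \<Union>F\<close> and
  \<open>A - \<Union>G\<close> is \<open>A - \<Union>(F \<union> G)\<close>.\<close>

lemma complemented_filterE:
  assumes "Y \<in> complemented_filter \<I> A"
  obtains F where "finite F" "F \<subseteq> \<I>" "A \<notin> F" "A - \<Union>F \<subseteq> Y"
proof -
  obtain \<G> where \<G>: "finite \<G>" "\<G> \<subseteq> {A - \<Union>F | F. finite F \<and> F \<subseteq> \<I> \<and> A \<notin> F}" "\<Inter>\<G> \<subseteq> Y"
    using assms unfolding complemented_filter_def generated_filter_def by blast
  have "\<exists>F. finite F \<and> F \<subseteq> \<I> \<and> A \<notin> F \<and> A - \<Union>F \<subseteq> \<Inter>\<G>"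
    using \<G>(1,2)
  proof (induction rule: finite_induct)
    case empty
    show ?case by (intro exI[of _ "{}"]) auto
  next
    case (insert X \<G>)
    then obtain F G where "finite F" "F \<subseteq> \<I>" "A \<notin> F" "A - \<Union>F \<subseteq> \<Inter>\<G>"
      and "finite G" "G \<subseteq> \<I>" "A \<notin> G" "X = A - \<Union>G" by auto
    then show ?case by (intro exI[of _ "F \<union> G"]) auto
  qed
  with \<G>(3) that show thesis by (meson order_trans)
qed

lemma ideal_independentD:
  "ideal_independent \<I> \<Longrightarrow> (\<And>i. i < n \<Longrightarrow> X i \<in> \<I>) \<Longrightarrow> A \<in> \<I> \<Longrightarrow> A \<subseteq>\<^sup>* (\<Union>i<n. X i) \<Longrightarrow> \<exists>i<n. X i = A"
  for n :: nat
  by (simp add: ideal_independent_def)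

text \<open>Phrased through the absence of a violating triple, so that failure of independence for
  an enlarged family yields such a triple.\<close>

lemma ideal_independent_iff:
  "ideal_independent \<I> \<longleftrightarrow> (\<forall>X\<in>\<I>. infinite X) \<and>
    \<not> (\<exists>(n::nat) X A. (\<forall>i<n. X i \<in> \<I>) \<and> A \<in> \<I> \<and> A \<subseteq>\<^sup>* (\<Union>i<n. X i) \<and> \<not> (\<exists>i<n. X i = A))"
proof -
  have *: "(\<forall>n X A. Q n X A \<longrightarrow> R n X A) \<longleftrightarrow> \<not> (\<exists>n X A. Q n X A \<and> \<not> R n X A)"
    for Q R :: "nat \<Rightarrow> (nat \<Rightarrow> nat set) \<Rightarrow> nat set \<Rightarrow> bool" by blast
  show ?thesis unfolding ideal_independent_def * conj_assoc by (rule refl)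
qed

text \<open>If \<open>C\<close> is infinite and not in \<open>\<I>\<close>, then by maximality
  adding it creates a violation \<open>A \<subseteq>\<^sup>* (\<Union>i<n. X i)\<close>. For
  \<open>A = C\<close> this is the desired covering. For \<open>A \<in> \<I>\<close> the set
  \<open>A\<close> without the covering sets other than \<open>C\<close> is almost contained in
  \<open>C\<close>, which puts \<open>C\<close> into
  \<open>complemented_filter \<I> A\<close>.\<close>

lemma almost_covered_if_not_in_complemented_filters:
  assumes max: "maximal_ideal_independent \<I>"
    and pp: "\<And>A. A \<in> \<I> \<Longrightarrow> p_point (complemented_filter \<I> A)"
    and C: "\<And>A. A \<in> \<I> \<Longrightarrow> C \<notin> complemented_filter \<I> A"
  obtains F where "finite F" "F \<subseteq> \<I>" "C \<subseteq>\<^sup>* \<Union>F"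
proof (cases "finite C \<or> C \<in> \<I>")
  case True
  then show thesis
  proof
    assume "finite C"
    then show thesis by (intro that[of "{}"]) (auto simp: almost_subset_def)
  next
    assume "C \<in> \<I>"
    then show thesis by (intro that[of "{C}"]) (auto simp: almost_subset_def)
  qed
next
  case False
  have ii: "ideal_independent \<I>" using max by (simp add: maximal_ideal_independent_def)
  have "\<not> ideal_independent (insert C \<I>)"
  proof
    assume "ideal_independent (insert C \<I>)"
    then have "insert C \<I> = \<I>"
      using max unfolding maximal_ideal_independent_def by (meson subset_insertI)
    then show False using False by blast
  qed
  moreover have "\<forall>X\<in>insert C \<I>. infinite X"
    using ii False by (auto simp: ideal_independent_def)
  ultimately have "\<exists>(n::nat) X A. (\<forall>i<n. X i \<in> insert C \<I>) \<and> A \<in> insert C \<I> \<and>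
      A \<subseteq>\<^sup>* (\<Union>i<n. X i) \<and> \<not> (\<exists>i<n. X i = A)"
    unfolding ideal_independent_iff by satx
  then obtain n :: nat and X A where X: "\<forall>i<n. X i \<in> insert C \<I>" and A: "A \<in> insert C \<I>"
    and sub: "A \<subseteq>\<^sup>* (\<Union>i<n. X i)" and ne: "\<And>i. i < n \<Longrightarrow> X i \<noteq> A"
    by auto
  define F where "F = X ` {..<n} - {C}"
  have F: "finite F" "F \<subseteq> \<I>" "A \<notin> F" using X ne by (auto simp: F_def)
  show thesis
  proof (cases "A = C")
    case True
    then have "F = X ` {..<n}" using ne by (auto simp: F_def)
    then show thesis using sub F True by (intro that[of F]) auto
  next
    case False
    then have AI: "A \<in> \<I>" using A by simp
    have uf: "ultrafilter_on_nat (complemented_filter \<I> A)"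
      using pp[OF AI] by (simp add: p_point_def)
    define B where "B = A - (\<Union>i<n. X i)"
    have fB: "finite B" using sub by (simp add: B_def almost_subset_def)
    \<comment> \<open>The finite error \<open>B\<close> is removed by intersecting with the cofinite
      set \<open>- B\<close>, which every p-point contains.\<close>
    have "A - \<Union>F \<subseteq> C \<union> B" by (auto simp: F_def B_def)
    then have "C \<union> B \<in> complemented_filter \<I> A" using F by (intro complemented_filterI)
    moreover have "- B \<in> complemented_filter \<I> A" using pp[OF AI] fB by (rule cofinite_mem_p_point)
    ultimately have "(C \<union> B) \<inter> - B \<in> complemented_filter \<I> A"
      by (rule ultrafilter_Int[OF uf])
    then have "C \<in> complemented_filter \<I> A" by (rule ultrafilter_mono[OF uf]) auto
    with C[OF AI] show thesis by contradiction
  qed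
qed

section \<open>Stationarity of the set of all countable subsets\<close>

text \<open>Closing the empty set under \<open>F\<close> in countably many steps gives a countable
  closed set, because each finite list over the union is a list over some stage.\<close>

lemma stationary_countable_subsets: "stationary X {a. a \<subseteq> X \<and> countable a}"
  unfolding stationary_def
proof (intro conjI ballI allI impI)
  fix F :: "'a list \<Rightarrow> 'a" assume F: "\<forall>s\<in>lists X. F s \<in> X"
  define A where "A = rec_nat {} (\<lambda>_ a. a \<union> F ` lists a)"
  have A0: "A 0 = {}" and AS: "A (Suc n) = A n \<union> F ` lists (A n)" for n by (simp_all add: A_def)
  have sub: "A n \<subseteq> X" for n
    by (induction n) (use F in \<open>auto simp: A0 AS\<close>)
  have count: "countable (A n)" for n
    by (induction n) (auto simp: A0 AS)
  have mono: "A m \<subseteq> A n" if "m \<le> n" for m n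
    using that by (induction rule: dec_induct) (auto simp: AS)
  have lists_UN: "\<exists>n. s \<in> lists (A n)" if "s \<in> lists (\<Union>n. A n)" for s
    using that
  proof (induction s)
    case Nil
    show ?case by simp
  next
    case (Cons x s)
    then obtain m n where "x \<in> A m" "s \<in> lists (A n)" by blast
    then have "x # s \<in> lists (A (max m n))"
      using mono[of m "max m n"] mono[of n "max m n"] by auto
    then show ?case ..
  qed
  have "F s \<in> (\<Union>n. A n)" if s: "s \<in> lists (\<Union>n. A n)" for s
  proof -
    obtain n where "s \<in> lists (A n)" using lists_UN[OF s] ..
    then have "F s \<in> A (Suc n)" unfolding AS by (intro UnI2 imageI)
    then show ?thesis by (rule UN_I[OF UNIV_I])
  qed
  moreover have "(\<Union>n. A n) \<in> {a. a \<subseteq> X \<and> countable a}"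
    using sub count by (simp add: UN_subset_iff)
  ultimately show "\<exists>a\<in>{a. a \<subseteq> X \<and> countable a}. \<forall>s\<in>lists a. F s \<in> a" by blast
qed auto


section \<open>The forcing relation\<close>

locale forcing =
  fixes P :: "'p rel"
  assumes preorder: "Preorder P"
begin

abbreviation le  (infix "\<preceq>" 50) where "q \<preceq> p \<equiv> (q, p) \<in> P"

text \<open>Statements are arbitrary predicates on conditions, so their persistence under
  strengthening has to be demanded explicitly.\<close>

definition downward_closed :: "('p \<Rightarrow> bool) \<Rightarrow> bool"
  where "downward_closed \<phi> \<longleftrightarrow> (\<forall>p q. \<phi> p \<and> q \<preceq> p \<longrightarrow> \<phi> q)"

lemma le_refl: "p \<in> Field P \<Longrightarrow> p \<preceq> p"
  using preorder by (auto simp: preorder_on_def refl_on_def)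

lemma le_trans: "r \<preceq> q \<Longrightarrow> q \<preceq> p \<Longrightarrow> r \<preceq> p"
  using preorder by (auto simp: preorder_on_def elim: transE)

lemma le_refl_left: "q \<preceq> p \<Longrightarrow> q \<preceq> q"
  by (blast intro: le_refl FieldI1)

lemma downward_closedD: "downward_closed \<phi> \<Longrightarrow> \<phi> p \<Longrightarrow> q \<preceq> p \<Longrightarrow> \<phi> q"
  by (auto simp: downward_closed_def)

section \<open>Density below a condition\<close>

lemma dense_belowE:
  assumes "dense_below P \<phi> p" and "q \<preceq> p"
  obtains r where "r \<preceq> q" "r \<preceq> p" "\<phi> r"
  using assms le_trans[OF _ assms(2)] unfolding dense_below_def by blast

lemma dense_below_le: "dense_below P \<phi> p \<Longrightarrow> q \<preceq> p \<Longrightarrow> dense_below P \<phi> q"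
  unfolding dense_below_def using le_trans[of _ q p] by blast

lemma dense_below_mono:
  assumes "dense_below P \<phi> p" and "\<And>r. r \<preceq> p \<Longrightarrow> \<phi> r \<Longrightarrow> \<psi> r"
  shows "dense_below P \<psi> p"
  unfolding dense_below_def using assms(2) by (blast elim: dense_belowE[OF assms(1)])

lemma dense_below_dense_below:
  assumes "dense_below P (dense_below P \<phi>) p"
  shows "dense_below P \<phi> p"
  unfolding dense_below_def
proof (intro allI impI)
  fix q assume "q \<preceq> p"
  with assms obtain r where r: "r \<preceq> q" "dense_below P \<phi> r" by (rule dense_belowE)
  obtain s where "s \<preceq> r" "\<phi> s" using r(2) le_refl_left[OF r(1)] by (rule dense_belowE)
  then show "\<exists>r. r \<preceq> q \<and> \<phi> r" using le_trans[OF _ r(1)] by blast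
qed

text \<open>This is the rule for reasoning in the extension: strengthen \<open>p\<close> to decide a
  witness, argue below the stronger condition, and carry the conclusion back to
  \<open>p\<close>.\<close>

lemma dense_below_bind:
  assumes "dense_below P \<phi> p" and "\<And>r. r \<preceq> p \<Longrightarrow> \<phi> r \<Longrightarrow> dense_below P \<psi> r"
  shows "dense_below P \<psi> p"
  by (rule dense_below_dense_below[OF dense_below_mono[OF assms]])

lemma dense_belowI: "(\<And>q. q \<preceq> p \<Longrightarrow> \<phi> q) \<Longrightarrow> dense_below P \<phi> p"
  unfolding dense_below_def using le_refl_left by blast

text \<open>Conditions are strengthened once for each index; downward closure keeps the earlier
  witnesses valid.\<close>

lemma dense_below_finite_choice:
  assumes "\<And>i. i < (n::nat) \<Longrightarrow> dense_below P (\<lambda>r. \<exists>x. \<phi> i x r) p"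
    and "\<And>i x. downward_closed (\<phi> i x)"
  shows "dense_below P (\<lambda>r. \<exists>x. \<forall>i<n. \<phi> i (x i) r) p"
  using assms(1)
proof (induction n)
  case 0
  show ?case by (rule dense_belowI) simp
next
  case (Suc n)
  have "dense_below P (\<lambda>r. \<exists>x. \<forall>i<n. \<phi> i (x i) r) p" using Suc by simp
  then show ?case
  proof (rule dense_below_bind)
    fix r assume r: "r \<preceq> p" "\<exists>x. \<forall>i<n. \<phi> i (x i) r"
    then obtain x where x: "\<forall>i<n. \<phi> i (x i) r" by blast
    have "dense_below P (\<lambda>r. \<exists>y. \<phi> n y r) r" using Suc.prems[of n] r(1) by (simp add: dense_below_le)
    then show "dense_below P (\<lambda>r. \<exists>x. \<forall>i<Suc n. \<phi> i (x i) r) r"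
    proof (rule dense_below_mono)
      fix s assume s: "s \<preceq> r" "\<exists>y. \<phi> n y s"
      then obtain y where y: "\<phi> n y s" by blast
      have "\<forall>i<Suc n. \<phi> i ((x(n := y)) i) s"
        using x y by (simp add: less_Suc_eq downward_closedD[OF assms(2) _ s(1)])
      then show "\<exists>x. \<forall>i<Suc n. \<phi> i (x i) s" by blast
    qed
  qed
qed

section \<open>Membership and equality of names\<close>

lemma fmem_le: "fmem P x \<tau> p \<Longrightarrow> q \<preceq> p \<Longrightarrow> fmem P x \<tau> q"
  unfolding fmem_def by (rule dense_below_le)

lemma fmem_check:
  assumes "p \<in> Field P"
  shows "fmem P x (check P A) p \<longleftrightarrow> x \<in> A"
proof
  assume "x \<in> A"
  then show "fmem P x (check P A) p"
    unfolding fmem_def check_def using assms by (intro dense_belowI exI[of _ p]) auto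
next
  assume "fmem P x (check P A) p"
  then obtain r where "\<exists>s. (x, s) \<in> check P A \<and> r \<preceq> s"
    unfolding fmem_def using le_refl[OF assms] by (rule dense_belowE)
  then show "x \<in> A" by (auto simp: check_def)
qed

lemma feq_iff: "feq P \<tau> \<rho> p \<longleftrightarrow> (\<forall>x q. q \<preceq> p \<longrightarrow> (fmem P x \<tau> q \<longleftrightarrow> fmem P x \<rho> q))"
  unfolding feq_def fall_def fiff_def fconj_def fimp_def by auto

lemma feqD: "feq P \<tau> \<rho> p \<Longrightarrow> q \<preceq> p \<Longrightarrow> fmem P x \<tau> q \<longleftrightarrow> fmem P x \<rho> q"
  by (simp add: feq_iff)

lemma feqI: "(\<And>x q. q \<preceq> p \<Longrightarrow> fmem P x \<tau> q \<longleftrightarrow> fmem P x \<rho> q) \<Longrightarrow> feq P \<tau> \<rho> p"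
  by (simp add: feq_iff)

lemma feq_refl: "feq P \<tau> \<tau> p"
  by (rule feqI) simp

lemma feq_le: "feq P \<tau> \<rho> p \<Longrightarrow> q \<preceq> p \<Longrightarrow> feq P \<tau> \<rho> q"
  using le_trans[of _ q p] by (simp add: feq_iff)

lemma feq_checkD:
  assumes "feq P \<tau> (check P A) p" and "q \<preceq> p"
  shows "fmem P x \<tau> q \<longleftrightarrow> x \<in> A"
  by (simp add: feqD[OF assms] fmem_check[OF FieldI1[OF assms(2)]])

lemma feq_check_check:
  assumes "p \<in> Field P" and "feq P (check P A) (check P B) p"
  shows "A = B"
  using feq_checkD[OF assms(2) le_refl[OF assms(1)]] by (simp add: fmem_check[OF assms(1)] set_eq_iff)

lemma fMem_le: "fMem P \<tau> \<sigma> p \<Longrightarrow> q \<preceq> p \<Longrightarrow> fMem P \<tau> \<sigma> q"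
  unfolding fMem_def by (rule dense_below_le)

lemma fMem_dense: "dense_below P (fMem P \<tau> \<sigma>) p \<Longrightarrow> fMem P \<tau> \<sigma> p"
  unfolding fMem_def by (rule dense_below_dense_below)

text \<open>The second components in \<open>check_family P \<A>\<close> range over all conditions,
  so \<open>r\<close> itself can serve; what remains is that densely many \<open>r\<close> identify
  \<open>\<tau>\<close> with a ground-model member.\<close>

lemma fMem_check_family:
  "fMem P \<tau> (check_family P \<A>) p \<longleftrightarrow> dense_below P (\<lambda>r. \<exists>A. A \<in> \<A> \<and> feq P \<tau> (check P A) r) p"
proof -
  have "(\<exists>\<rho> s. (\<rho>, s) \<in> check_family P \<A> \<and> r \<preceq> s \<and> feq P \<tau> \<rho> r) \<longleftrightarrow>
      (\<exists>A. A \<in> \<A> \<and> feq P \<tau> (check P A) r)" if "r \<preceq> r" for r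
    using that FieldI1[OF that] unfolding check_family_def by blast
  note * = this[OF le_refl_left]
  show ?thesis
    unfolding fMem_def by (rule iffI; erule dense_below_mono; simp add: *)
qed

lemma fMem_check: "A \<in> \<A> \<Longrightarrow> fMem P (check P A) (check_family P \<A>) p"
  unfolding fMem_check_family by (rule dense_belowI) (auto intro: feq_refl)

lemma fMem_check_family_finite:
  assumes "\<And>i. i < (n::nat) \<Longrightarrow> fMem P (X i) (check_family P \<A>) p"
  shows "dense_below P (\<lambda>r. \<exists>A. \<forall>i<n. A i \<in> \<A> \<and> feq P (X i) (check P (A i)) r) p"
  using assms unfolding fMem_check_family
  by (rule dense_below_finite_choice) (auto simp: downward_closed_def dest: feq_le)

section \<open>Names of functions, properness and bounding\<close>

lemma f_function_iff:
  "f_function P A B f p \<longleftrightarrow>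
    (\<forall>a b q. q \<preceq> p \<and> fmem P (a, b) f q \<longrightarrow> a \<in> A \<and> b \<in> B) \<and>
    (\<forall>a\<in>A. dense_below P (\<lambda>r. \<exists>b\<in>B. fmem P (a, b) f r) p) \<and>
    (\<forall>a\<in>A. \<forall>b\<in>B. \<forall>c\<in>B. \<forall>q. q \<preceq> p \<and> fmem P (a, b) f q \<and> fmem P (a, c) f q \<longrightarrow> b = c)"
  unfolding f_function_def fall_def fex_def fimp_def fconj_def fconst_def by auto

text \<open>Ties between possible values are broken by a well-order of \<open>B\<close>: the name denotes the least
  \<open>b\<close> such that some condition in the generic filter satisfies \<open>D a b\<close>.\<close>

lemma function_name:
  fixes D :: "'a \<Rightarrow> 'b \<Rightarrow> 'p \<Rightarrow> bool"
  assumes down: "\<And>a b. downward_closed (D a b)"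
    and dense: "\<And>a. a \<in> A \<Longrightarrow> dense_below P (\<lambda>t. \<exists>b\<in>B. D a b t) r"
  obtains f where "f_function P A B f r"
    and "\<And>a b q. fmem P (a, b) f q \<Longrightarrow> dense_below P (D a b) q"
proof -
  from well_ordering obtain W :: "'b rel" where W: "Well_order W" "Field W = UNIV"
    by (elim exE conjE)
  have wf: "wf (W - Id)" using W(1) by (simp add: well_order_on_def)
  have "total_on (Field W) W" using W(1) by (simp add: well_order_on_def linear_order_on_def)
  then have tot: "(b, c) \<in> W \<or> (c, b) \<in> W" if "b \<noteq> c" for b c
    using that unfolding W(2) total_on_def by simp
  \<comment> \<open>Such a \<open>t\<close> settles \<open>b\<close> as the least value at
    \<open>a\<close>: it satisfies \<open>D a b\<close>, and none of its extensions satisfies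
    \<open>D a c\<close> for a smaller \<open>c\<close> in \<open>B\<close>.\<close>
  define M where "M a b t \<longleftrightarrow> a \<in> A \<and> b \<in> B \<and> D a b t \<and>
    (\<forall>c\<in>B. (c, b) \<in> W - Id \<longrightarrow> \<not> (\<exists>s. s \<preceq> t \<and> D a c s))" for a b t
  define f where "f = {((a, b), t). M a b t}"
  have M_le: "M a b s" if "M a b t" "s \<preceq> t" for a b s t
    using that(1) downward_closedD[OF down _ that(2)] le_trans[OF _ that(2)] unfolding M_def by blast
  have fM: "dense_below P (M a b) q" if "fmem P (a, b) f q" for a b q
    using that unfolding fmem_def f_def
    by (rule dense_below_mono) (auto intro: M_le)
  have Mf: "fmem P (a, b) f q" if "M a b q" for a b q
    using that unfolding fmem_def f_def by (intro dense_belowI) auto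
  have uniq: "b = c" if "M a b t" "M a c t" "t \<preceq> t" for a b c t
    using that tot[of b c] unfolding M_def by blast
  have "f_function P A B f r"
    unfolding f_function_iff
  proof (intro conjI allI ballI impI)
    fix a b q assume "q \<preceq> r \<and> fmem P (a, b) f q"
    then have "dense_below P (M a b) q" "q \<preceq> q" using fM le_refl_left by auto
    then obtain t where "M a b t" by (rule dense_belowE)
    then show "a \<in> A" "b \<in> B" by (simp_all add: M_def)
  next
    fix a assume a: "a \<in> A"
    show "dense_below P (\<lambda>t. \<exists>b\<in>B. fmem P (a, b) f t) r"
      unfolding dense_below_def
    proof (intro allI impI)
      fix q assume q: "q \<preceq> r"
      \<comment> \<open>\<open>K\<close> consists of the values still possible below
        \<open>q\<close>. For its least element \<open>b\<close>, any \<open>t\<close> below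
        \<open>q\<close> with \<open>D a b t\<close> excludes all smaller values.\<close>
      define K where "K = {b \<in> B. \<exists>t. t \<preceq> q \<and> D a b t}"
      have "K \<noteq> {}" using dense[OF a] q by (rule dense_belowE) (auto simp: K_def)
      then obtain b where b: "b \<in> K" "\<And>c. (c, b) \<in> W - Id \<Longrightarrow> c \<notin> K"
        using wf by (metis ex_in_conv wfE_min)
      then obtain t where t: "t \<preceq> q" "D a b t" "b \<in> B" by (auto simp: K_def)
      have "\<not> (\<exists>s. s \<preceq> t \<and> D a c s)" if "c \<in> B" "(c, b) \<in> W - Id" for c
        using b(2)[OF that(2)] that(1) le_trans[OF _ t(1)] by (auto simp: K_def)
      then have "M a b t" using a t by (simp add: M_def)
      then show "\<exists>t. t \<preceq> q \<and> (\<exists>b\<in>B. fmem P (a, b) f t)" using Mf t by blast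
    qed
  next
    fix a b c q assume q: "q \<preceq> r \<and> fmem P (a, b) f q \<and> fmem P (a, c) f q"
    then have qq: "q \<preceq> q" using le_refl_left by blast
    have "dense_below P (M a b) q" using q fM by auto
    then obtain t where t: "t \<preceq> q" "M a b t" using qq by (rule dense_belowE)
    have "dense_below P (M a c) q" using q fM by auto
    then obtain s where s: "s \<preceq> t" "M a c s" using t(1) by (rule dense_belowE)
    show "b = c" using M_le[OF t(2) s(1)] s(2) le_refl_left[OF s(1)] by (rule uniq)
  qed
  moreover have "dense_below P (D a b) q" if "fmem P (a, b) f q" for a b q
    using fM[OF that] by (rule dense_below_mono) (simp add: M_def)
  ultimately show thesis by (rule that)
qed

text \<open>Properness is applied to the stationary set of all countable sets of conditions and to a
  function sending every sequence of length \<open>n\<close> to a condition in the generic filter that lies in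
  the \<open>n\<close>th dense set.\<close>

lemma proper_countable_cover:
  assumes "proper P" and r: "r \<in> Field P"
    and dense: "\<And>n::nat. dense_below P (\<lambda>p. p \<in> E n) r"
  obtains q b where "q \<preceq> r" "countable b"
    and "\<And>n. dense_below P (\<lambda>t. \<exists>p\<in>b \<inter> E n. t \<preceq> p) q"
proof -
  \<comment> \<open>Conditions are coded as singletons because \<open>proper\<close> speaks about
    sets of sets of conditions.\<close>
  define X where "X = (\<lambda>p. {p}) ` Field P"
  define D where "D s x t \<longleftrightarrow> (\<exists>p\<in>E (length s). x = {p} \<and> t \<preceq> p)" for s :: "'p set list" and x t
  have "downward_closed (D s x)" for s x
    by (auto simp: downward_closed_def D_def intro: le_trans)
  moreover have "dense_below P (\<lambda>t. \<exists>x\<in>X. D s x t) r" for s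
    using dense[of "length s"]
    by (rule dense_below_mono) (auto simp: D_def X_def intro: FieldI1 dest: le_refl_left)
  ultimately obtain f where f: "f_function P (lists X) X f r"
    and fD: "\<And>s x q. fmem P (s, x) f q \<Longrightarrow> dense_below P (D s x) q"
    using function_name[of D "lists X" X r] by blast
  have "f_stationary P X (check_family P {a. a \<subseteq> X \<and> countable a}) r"
    using assms(1) r stationary_countable_subsets unfolding proper_def forced_def by blast
  then have "dense_below P (\<lambda>q. \<exists>a. fMem P a (check_family P {a. a \<subseteq> X \<and> countable a}) q \<and>
      (\<forall>s\<in>lists X. \<forall>y\<in>X. \<forall>t. t \<preceq> q \<and> (\<forall>x\<in>set s. fmem P x a t) \<and> fmem P (s, y) f t
        \<longrightarrow> fmem P y a t)) r"
    using f le_refl[OF r] unfolding f_stationary_def fall_def fimp_def fex_def fconj_def by simp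
  then obtain q1 a where q1: "q1 \<preceq> r" and
    "dense_below P (\<lambda>t. \<exists>b. b \<in> {a. a \<subseteq> X \<and> countable a} \<and> feq P a (check P b) t) q1" and
    cl: "\<And>s y t. s \<in> lists X \<Longrightarrow> y \<in> X \<Longrightarrow> t \<preceq> q1 \<Longrightarrow> \<forall>x\<in>set s. fmem P x a t \<Longrightarrow>
      fmem P (s, y) f t \<Longrightarrow> fmem P y a t"
    unfolding fMem_check_family using le_refl[OF r] by (elim dense_belowE) blast+
  then obtain q b where q: "q \<preceq> q1" and b: "b \<subseteq> X" "countable b" and ab: "feq P a (check P b) q"
    using le_refl_left[OF q1] by (elim dense_belowE) blast+
  have qr: "q \<preceq> r" using q q1 le_trans by blast
  \<comment> \<open>Since \<open>q\<close> identifies \<open>a\<close> with \<open>b\<close>,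
    closure of \<open>a\<close> under \<open>f\<close> turns into closure of \<open>b\<close>: the
    value of \<open>f\<close> at \<open>s\<close> lies in \<open>b\<close> and codes a condition in
    \<open>E (length s)\<close>.\<close>
  have step: "dense_below P (\<lambda>t. \<exists>p\<in>E (length s). {p} \<in> b \<and> t \<preceq> p) q" if s: "s \<in> lists b" for s
  proof -
    have sX: "s \<in> lists X" using s b by auto
    then have "dense_below P (\<lambda>t. \<exists>y\<in>X. fmem P (s, y) f t) q"
      using f qr dense_below_le unfolding f_function_iff by blast
    then show ?thesis
    proof (rule dense_below_bind)
      fix t assume t: "t \<preceq> q" "\<exists>y\<in>X. fmem P (s, y) f t"
      then obtain y where y: "y \<in> X" "fmem P (s, y) f t" by blast
      have "\<forall>x\<in>set s. fmem P x a t" using s feq_checkD[OF ab t(1)] by auto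
      then have "fmem P y a t" using cl sX y t(1) q le_trans by blast
      then have "y \<in> b" using feq_checkD[OF ab t(1)] by auto
      show "dense_below P (\<lambda>t. \<exists>p\<in>E (length s). {p} \<in> b \<and> t \<preceq> p) t"
        using fD[OF y(2)] by (rule dense_below_mono) (use \<open>y \<in> b\<close> in \<open>auto simp: D_def\<close>)
    qed
  qed
  \<comment> \<open>The empty list yields an element of \<open>b\<close>, and repeating it gives
    lists over \<open>b\<close> of every length, so that each \<open>E n\<close> is reached.\<close>
  obtain p where p: "{p} \<in> b" using step[of "[]"] le_refl_left[OF qr] by (auto elim: dense_belowE)
  have "countable (\<Union>x\<in>b. x)"
    using b(2) by (rule countable_UN) (use b(1) in \<open>auto simp: X_def\<close>)
  moreover have "dense_below P (\<lambda>t. \<exists>p\<in>(\<Union>x\<in>b. x) \<inter> E n. t \<preceq> p) q" for n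
    by (rule dense_below_mono[OF step[of "replicate n {p}"]]) (use p in auto)
  ultimately show thesis using qr by (intro that)
qed

text \<open>Properness leaves countably many conditions deciding the witnesses. The index of a
  suitable one in a fixed enumeration is a function in the extension; a ground-model bound for it
  leaves finitely many candidates for each \<open>n\<close>.\<close>

lemma proper_bounding_finite_cover:
  fixes D :: "nat \<Rightarrow> 'x \<Rightarrow> 'p \<Rightarrow> bool"
  assumes "proper P" and "omega_omega_bounding P" and r: "r \<in> Field P"
    and down: "\<And>n x. downward_closed (D n x)"
    and dense: "\<And>n. dense_below P (\<lambda>t. \<exists>x. D n x t) r"
  obtains q H where "q \<preceq> r" and "\<And>n. finite (H n)"
    and "\<And>n. dense_below P (\<lambda>t. \<exists>x\<in>H n. D n x t) q"
proof -
  define E where "E n = {p. \<exists>x. D n x p}" for n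
  have "dense_below P (\<lambda>p. p \<in> E n) r" for n using dense[of n] by (simp add: E_def)
  then obtain q1 b where q1: "q1 \<preceq> r" and b: "countable b"
    and bE: "\<And>n. dense_below P (\<lambda>t. \<exists>p\<in>b \<inter> E n. t \<preceq> p) q1"
    using proper_countable_cover[OF assms(1) r] by blast
  \<comment> \<open>\<open>D' n k\<close> expresses that the \<open>k\<close>th condition of the
    enumeration decides a witness for \<open>n\<close> and belongs to the generic filter.\<close>
  define D' where "D' n k t \<longleftrightarrow> from_nat_into b k \<in> E n \<and> t \<preceq> from_nat_into b k" for n k t
  have "downward_closed (D' n k)" for n k
    by (auto simp: downward_closed_def D'_def intro: le_trans)
  moreover have "dense_below P (\<lambda>t. \<exists>k\<in>UNIV. D' n k t) q1" for n
    using bE[of n] by (rule dense_below_mono) (metis D'_def IntE UNIV_I b from_nat_into_surj)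
  ultimately obtain f where f: "f_function P UNIV UNIV f q1"
    and fD: "\<And>n k q. fmem P (n, k) f q \<Longrightarrow> dense_below P (D' n k) q"
    using function_name[of D' UNIV UNIV q1] by blast
  have q1F: "q1 \<in> Field P" using q1 by (auto simp: Field_def)
  have "dense_below P (\<lambda>q. \<exists>g. \<forall>n m t. t \<preceq> q \<and> fmem P (n, m) f t \<longrightarrow> m \<le> g n) q1"
    using assms(2) f q1F le_refl[OF q1F]
    unfolding omega_omega_bounding_def forced_def fall_def fimp_def fex_def fconst_def by simp
  then obtain q g where q: "q \<preceq> q1" and g: "\<And>n m t. t \<preceq> q \<Longrightarrow> fmem P (n, m) f t \<Longrightarrow> m \<le> g n"
    using le_refl[OF q1F] by (elim dense_belowE) blast+
  \<comment> \<open>One witness is fixed in the ground model for each index up to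
    \<open>g n\<close>. Where the enumerated condition decides none, \<open>SOME\<close> only
    contributes an irrelevant element.\<close>
  define H where "H n = (\<lambda>k. SOME x. D n x (from_nat_into b k)) ` {..g n}" for n
  have "dense_below P (\<lambda>t. \<exists>x\<in>H n. D n x t) q" for n
  proof -
    have "dense_below P (\<lambda>t. \<exists>k. fmem P (n, k) f t) q"
      using f q dense_below_le unfolding f_function_iff by auto
    then show ?thesis
    proof (rule dense_below_bind)
      fix t assume t: "t \<preceq> q" "\<exists>k. fmem P (n, k) f t"
      then obtain k where k: "fmem P (n, k) f t" by blast
      then have "k \<le> g n" using g t by blast
      show "dense_below P (\<lambda>t. \<exists>x\<in>H n. D n x t) t"
        using fD[OF k]
      proof (rule dense_below_mono)
        fix s assume "D' n k s"
        then have "D n (SOME x. D n x (from_nat_into b k)) (from_nat_into b k)"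
          and "s \<preceq> from_nat_into b k" by (auto simp: D'_def E_def intro: someI_ex)
        then have "D n (SOME x. D n x (from_nat_into b k)) s" by (rule downward_closedD[OF down])
        then show "\<exists>x\<in>H n. D n x s" using \<open>k \<le> g n\<close> by (auto simp: H_def)
      qed
    qed
  qed
  moreover have "finite (H n)" for n by (simp add: H_def)
  ultimately show thesis using that[OF le_trans[OF q q1]] by blast
qed

section \<open>Negation and ultrafilters in the extension\<close>

lemma fneg_le: "fneg P \<phi> p \<Longrightarrow> q \<preceq> p \<Longrightarrow> fneg P \<phi> q"
  using le_trans[of _ q p] by (auto simp: fneg_def)

lemma fnegD: "fneg P \<phi> p \<Longrightarrow> q \<preceq> p \<Longrightarrow> \<not> \<phi> q"
  by (simp add: fneg_def)

lemma fneg_fmem_dense: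
  assumes "dense_below P (fneg P (fmem P x \<tau>)) p"
  shows "fneg P (fmem P x \<tau>) p"
  unfolding fneg_def
proof (intro allI impI notI)
  fix q assume q: "q \<preceq> p" "fmem P x \<tau> q"
  obtain r where r: "r \<preceq> q" "fneg P (fmem P x \<tau>) r" using assms q(1) by (rule dense_belowE)
  then show False using fnegD[OF r(2) le_refl_left[OF r(1)]] fmem_le[OF q(2) r(1)] by simp
qed

text \<open>The name collects all pairs \<open>(x, s)\<close> such that \<open>s\<close> forces
  \<open>x\<close> not to be in \<open>\<tau>\<close>.\<close>

lemma complement_name:
  obtains \<rho> where "\<And>x p. p \<in> Field P \<Longrightarrow> fmem P x \<rho> p \<longleftrightarrow> fneg P (fmem P x \<tau>) p"
proof
  fix x p assume p: "p \<in> Field P"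
  let ?\<rho> = "{(x, s). fneg P (fmem P x \<tau>) s}"
  show "fmem P x ?\<rho> p \<longleftrightarrow> fneg P (fmem P x \<tau>) p"
  proof
    assume "fmem P x ?\<rho> p"
    then have "dense_below P (fneg P (fmem P x \<tau>)) p"
      unfolding fmem_def[of _ _ ?\<rho>] by (rule dense_below_mono) (auto intro: fneg_le)
    then show "fneg P (fmem P x \<tau>) p" by (rule fneg_fmem_dense)
  next
    assume "fneg P (fmem P x \<tau>) p"
    then show "fmem P x ?\<rho> p"
      unfolding fmem_def[of _ _ ?\<rho>] by (intro dense_belowI exI[of _ p]) auto
  qed
qed

text \<open>The finitely many generators can be identified with ground-model sets, and their
  intersection is again in \<open>\<F>\<close>.\<close>

lemma f_generated_filter_check_familyD:
  assumes uf: "ultrafilter_on_nat \<F>" and "f_generated_filter P (check_family P \<F>) Y p"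
  shows "dense_below P (\<lambda>r. \<exists>X\<in>\<F>. \<forall>k\<in>X. fmem P k Y r) p"
proof -
  have "dense_below P (\<lambda>q. \<exists>n::nat. dense_below P (\<lambda>r. \<exists>X.
      (\<forall>i<n. fMem P (X i) (check_family P \<F>) r) \<and>
      (\<forall>k t. t \<preceq> r \<and> (\<forall>i<n. fmem P k (X i) t) \<longrightarrow> fmem P k Y t)) q) p"
    using assms(2) unfolding f_generated_filter_def fex_def fall_def fconj_def fimp_def
    by (simp add: Ball_def)
  then show ?thesis
  proof (rule dense_below_bind, elim exE, elim dense_below_bind, elim exE conjE)
    fix r and n :: nat and X
    assume X: "\<forall>i<n. fMem P (X i) (check_family P \<F>) r"
      and Y: "\<forall>k t. t \<preceq> r \<and> (\<forall>i<n. fmem P k (X i) t) \<longrightarrow> fmem P k Y t"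
    have "dense_below P (\<lambda>r. \<exists>A. \<forall>i<n. A i \<in> \<F> \<and> feq P (X i) (check P (A i)) r) r"
      using X by (intro fMem_check_family_finite) simp
    then show "dense_below P (\<lambda>r. \<exists>X\<in>\<F>. \<forall>k\<in>X. fmem P k Y r) r"
    proof (rule dense_below_mono)
      fix t assume t: "t \<preceq> r" and "\<exists>A. \<forall>i<n. A i \<in> \<F> \<and> feq P (X i) (check P (A i)) t"
      then obtain A where A: "\<And>i. i < n \<Longrightarrow> A i \<in> \<F>"
        and XA: "\<And>i. i < n \<Longrightarrow> feq P (X i) (check P (A i)) t" by auto
      have "\<Inter>(A ` {..<n}) \<in> \<F>" using A by (intro Inter_mem_ultrafilter[OF uf]) auto
      moreover have "fmem P k Y t" if "k \<in> \<Inter>(A ` {..<n})" for k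
        using Y t that feq_checkD[OF XA le_refl_left[OF t]] by simp
      ultimately show "\<exists>X\<in>\<F>. \<forall>k\<in>X. fmem P k Y t" by blast
    qed
  qed
qed

text \<open>In the extension \<open>\<F>\<close> generates an ultrafilter, which contains
  \<open>Y\<close> or its complement; in either case a ground-model member of \<open>\<F>\<close> is
  a subset.\<close>

lemma p_point_decides:
  assumes "preserves_p_points P" and pp: "p_point \<F>" and p: "p \<in> Field P"
  shows "dense_below P (\<lambda>r. (\<exists>X\<in>\<F>. \<forall>k\<in>X. fmem P k Y r) \<or>
    (\<exists>X\<in>\<F>. \<forall>k\<in>X. fneg P (fmem P k Y) r)) p" (is "dense_below P ?D p")
proof -
  have uf: "ultrafilter_on_nat \<F>" using pp by (simp add: p_point_def)
  obtain Z where "\<And>k p. p \<in> Field P \<Longrightarrow> fmem P k Z p \<longleftrightarrow> fneg P (fmem P k Y) p"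
    using complement_name[of Y] by blast
  then have Z: "fmem P k Z q \<longleftrightarrow> fneg P (fmem P k Y) q" if "q \<preceq> p" for k q
    using FieldI1[OF that] by blast
  have gen: "f_generates_ultrafilter P (check_family P \<F>) p"
    using assms unfolding preserves_p_points_def forced_def by simp
  have "\<forall>k. fiff P (fmem P k Z) (fneg P (fmem P k Y)) p"
    unfolding fiff_def fconj_def fimp_def using Z by auto
  then have "dense_below P (\<lambda>r. f_generated_filter P (check_family P \<F>) Y r \<or>
      f_generated_filter P (check_family P \<F>) Z r) p"
    using gen le_refl[OF p]
    unfolding f_generates_ultrafilter_def fdisj_def fall_def fconj_def fimp_def by simp
  then show ?thesis
  proof (rule dense_below_bind, elim disjE)
    fix r assume r: "r \<preceq> p" and "f_generated_filter P (check_family P \<F>) Y r"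
    then have "dense_below P (\<lambda>r. \<exists>X\<in>\<F>. \<forall>k\<in>X. fmem P k Y r) r"
      by (intro f_generated_filter_check_familyD[OF uf])
    then show "dense_below P ?D r" by (rule dense_below_mono) simp
  next
    fix r assume r: "r \<preceq> p" and "f_generated_filter P (check_family P \<F>) Z r"
    then have "dense_below P (\<lambda>r. \<exists>X\<in>\<F>. \<forall>k\<in>X. fmem P k Z r) r"
      by (intro f_generated_filter_check_familyD[OF uf])
    then show "dense_below P ?D r"
      by (rule dense_below_mono) (simp add: Z[OF le_trans[OF _ r]])
  qed
qed

section \<open>Ideal independence in the extension\<close>

lemma f_ideal_independent_iff:
  "f_ideal_independent P \<sigma> p \<longleftrightarrow>
    (\<forall>X q. q \<preceq> p \<and> fMem P X \<sigma> q \<longrightarrow> f_infinite P X q) \<and>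
    (\<forall>n X A q. q \<preceq> p \<and> (\<forall>i<n. fMem P (X i) \<sigma> q) \<and> fMem P A \<sigma> q \<and> f_almost_covered P A n X q \<longrightarrow>
      dense_below P (\<lambda>r. \<exists>i<n. feq P (X i) A r) q)"
  unfolding f_ideal_independent_def fall_def fex_def fimp_def fconj_def
  by (simp add: Ball_def Bex_def)

lemma f_infinite_iff: "f_infinite P X p \<longleftrightarrow> (\<forall>m. dense_below P (\<lambda>r. \<exists>k\<ge>m. fmem P k X r) p)"
  unfolding f_infinite_def fall_def fex_def by (simp add: Bex_def)

lemma f_almost_covered_iff:
  "f_almost_covered P A n X p \<longleftrightarrow> dense_below P (\<lambda>r. \<exists>m. \<forall>k\<ge>m. \<forall>s. s \<preceq> r \<and> fmem P k A s \<longrightarrow>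
    dense_below P (\<lambda>t. \<exists>i<n. fmem P k (X i) t) s) p"
  unfolding f_almost_covered_def fall_def fex_def fimp_def by (simp add: Bex_def Ball_def)

text \<open>Independence is absolute: once a condition decides which ground-model sets are meant and
  where the covering begins, the almost inclusion already holds in the ground model.\<close>

lemma f_ideal_independent_check_family:
  assumes ii: "ideal_independent \<I>"
  shows "f_ideal_independent P (check_family P \<I>) p"
  unfolding f_ideal_independent_iff
proof (intro conjI allI impI; elim conjE)
  fix X q assume "fMem P X (check_family P \<I>) q"
  then have X: "dense_below P (\<lambda>r. \<exists>A. A \<in> \<I> \<and> feq P X (check P A) r) q"
    by (simp add: fMem_check_family)
  show "f_infinite P X q"
    unfolding f_infinite_iff
  proof
    fix m :: nat
    show "dense_below P (\<lambda>r. \<exists>k\<ge>m. fmem P k X r) q"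
      using X
    proof (rule dense_below_mono, elim exE conjE)
      fix r A assume r: "r \<preceq> q" and A: "A \<in> \<I>" "feq P X (check P A) r"
      have "infinite A" using ii A(1) by (simp add: ideal_independent_def)
      then obtain k where "m \<le> k" "k \<in> A" by (auto simp: infinite_nat_iff_unbounded_le)
      then show "\<exists>k\<ge>m. fmem P k X r" using feq_checkD[OF A(2) le_refl_left[OF r]] by blast
    qed
  qed
next
  fix n X A q
  assume X: "\<forall>i<n. fMem P (X i) (check_family P \<I>) q" and "fMem P A (check_family P \<I>) q"
    and cov: "f_almost_covered P A n X q"
  then have "dense_below P (\<lambda>r. \<exists>A'. A' \<in> \<I> \<and> feq P A (check P A') r) q"
    by (simp add: fMem_check_family)
  then show "dense_below P (\<lambda>r. \<exists>i<n. feq P (X i) A r) q"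
  proof (rule dense_below_bind, elim exE conjE)
    fix r A' assume r: "r \<preceq> q" and A': "A' \<in> \<I>" "feq P A (check P A') r"
    have "dense_below P (\<lambda>s. \<exists>B. \<forall>i<n. B i \<in> \<I> \<and> feq P (X i) (check P (B i)) s) r"
      using X fMem_le[OF _ r] by (intro fMem_check_family_finite) blast
    then show "dense_below P (\<lambda>r. \<exists>i<n. feq P (X i) A r) r"
    proof (rule dense_below_bind, elim exE)
      fix s B assume s: "s \<preceq> r" and B: "\<forall>i<n. B i \<in> \<I> \<and> feq P (X i) (check P (B i)) s"
      have "f_almost_covered P A n X s"
        using cov dense_below_le[OF _ le_trans[OF s r]] unfolding f_almost_covered_iff by blast
      then show "dense_below P (\<lambda>r. \<exists>i<n. feq P (X i) A r) s"
        unfolding f_almost_covered_iff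
      proof (rule dense_below_bind, elim exE)
        fix t m assume t: "t \<preceq> s" and
          m: "\<forall>k\<ge>m. \<forall>s. s \<preceq> t \<and> fmem P k A s \<longrightarrow> dense_below P (\<lambda>t. \<exists>i<n. fmem P k (X i) t) s"
        have tr: "t \<preceq> r" using t s by (rule le_trans)
        \<comment> \<open>Points from \<open>m\<close> on are forced into some \<open>X i\<close>,
          which is identified with \<open>B i\<close>; so only points below \<open>m\<close> can
          escape.\<close>
        have "A' - (\<Union>i<n. B i) \<subseteq> {..<m}"
        proof (rule subsetI, rule ccontr)
          fix k assume k: "k \<in> A' - (\<Union>i<n. B i)" "k \<notin> {..<m}"
          then have "fmem P k A t" using feq_checkD[OF A'(2) tr] by blast
          then have "dense_below P (\<lambda>t. \<exists>i<n. fmem P k (X i) t) t"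
            using m k(2) le_refl_left[OF t] by simp
          then obtain u i where u: "u \<preceq> t" "i < n" "fmem P k (X i) u"
            using le_refl_left[OF t] by (elim dense_belowE) auto
          have Xi: "feq P (X i) (check P (B i)) s" using B u(2) by simp
          have "k \<in> B i" using feq_checkD[OF Xi le_trans[OF u(1) t]] u(3) by simp
          then show False using k u(2) by blast
        qed
        then have "A' \<subseteq>\<^sup>* (\<Union>i<n. B i)"
          unfolding almost_subset_def by (rule finite_subset) simp
        then obtain i where i: "i < n" "B i = A'"
          using ideal_independentD[OF ii, of n B A'] A'(1) B by blast
        have Xi: "feq P (X i) (check P A') s" using B i by auto
        have "feq P (X i) A t"
          unfolding feq_iff
          using feq_checkD[OF Xi le_trans[OF _ t]] feq_checkD[OF A'(2) le_trans[OF _ tr]] by simp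
        then have "\<exists>i<n. feq P (X i) A u" if "u \<preceq> t" for u
          using i(1) feq_le[OF _ that] by (intro exI[of _ i]) simp
        then show "dense_below P (\<lambda>r. \<exists>i<n. feq P (X i) A r) t" by (rule dense_belowI)
      qed
    qed
  qed
qed

section \<open>Members of an independent family extending the given one\<close>

text \<open>\<open>A\<close> is covered by \<open>Y\<close> and a finite
  \<open>F \<subseteq> \<I>\<close> with \<open>A \<notin> F\<close>. Independence of
  \<open>\<tau>\<close> makes \<open>A\<close> equal to one of the covering sets, which can only be
  \<open>Y\<close>.\<close>

lemma fMem_check_family_if_complemented:
  assumes indep: "f_ideal_independent P \<tau> q" and rq: "r \<preceq> q"
    and sub: "\<And>B. B \<in> \<I> \<Longrightarrow> fMem P (check P B) \<tau> r"
    and Y: "fMem P Y \<tau> r"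
    and A: "A \<in> \<I>" and X: "X \<in> complemented_filter \<I> A"
    and XY: "\<And>k. k \<in> X \<Longrightarrow> fmem P k Y r"
  shows "fMem P Y (check_family P \<I>) r"
proof -
  obtain F where F: "finite F" "F \<subseteq> \<I>" "A \<notin> F" "A - \<Union>F \<subseteq> X"
    using X by (rule complemented_filterE)
  obtain n :: nat and B where B: "F = B ` {..<n}"
    using finite_imp_nat_seg_image_inj_on[OF F(1)] by (auto simp: lessThan_def)
  \<comment> \<open>The members of \<open>F\<close> take the indices below \<open>n\<close>, and
    \<open>Y\<close> takes index \<open>n\<close>.\<close>
  define Z where "Z i = (if i < n then check P (B i) else Y)" for i
  have "\<forall>i<Suc n. fMem P (Z i) \<tau> r" using sub Y F(2) by (auto simp: Z_def B)
  moreover have "f_almost_covered P (check P A) (Suc n) Z r"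
    unfolding f_almost_covered_iff
  proof (rule dense_belowI, intro exI[of _ 0] allI impI, elim conjE)
    fix s k t assume s: "s \<preceq> r" and t: "t \<preceq> s" and k: "fmem P k (check P A) t"
    have "k \<in> A" using k by (simp add: fmem_check[OF FieldI1[OF t]])
    show "dense_below P (\<lambda>t. \<exists>i<Suc n. fmem P k (Z i) t) t"
    proof (rule dense_belowI)
      fix u assume u: "u \<preceq> t"
      show "\<exists>i<Suc n. fmem P k (Z i) u"
      proof (cases "k \<in> \<Union>F")
        case True
        then obtain i where "i < n" "k \<in> B i" by (auto simp: B)
        then show ?thesis
          by (intro exI[of _ i]) (simp add: Z_def fmem_check[OF FieldI1[OF u]])
      next
        case False
        then have "fmem P k Y r" using XY F(4) \<open>k \<in> A\<close> by blast
        then have "fmem P k Y u" using le_trans[OF u le_trans[OF t s]] by (rule fmem_le)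
        then show ?thesis by (intro exI[of _ n]) (simp add: Z_def)
      qed
    qed
  qed
  ultimately have "dense_below P (\<lambda>s. \<exists>i<Suc n. feq P (Z i) (check P A) s) r"
    using indep rq sub[OF A] unfolding f_ideal_independent_iff by simp
  then show ?thesis
    unfolding fMem_check_family
  proof (rule dense_below_mono, elim exE conjE)
    fix s i assume s: "s \<preceq> r" and i: "i < Suc n" "feq P (Z i) (check P A) s"
    have "\<not> i < n"
    proof
      assume "i < n"
      then have "B i = A" using i feq_check_check[OF FieldI1[OF s]] by (simp add: Z_def)
      then show False using F(3) \<open>i < n\<close> by (auto simp: B)
    qed
    then show "\<exists>A. A \<in> \<I> \<and> feq P Y (check P A) s" using A i by (auto simp: Z_def)
  qed
qed

text \<open>The members of \<open>F\<close> belong to \<open>\<tau>\<close> and almost cover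
  \<open>Y\<close>, so independence of \<open>\<tau>\<close> makes \<open>Y\<close> equal to one of
  them.\<close>

lemma fMem_check_family_if_almost_covered:
  assumes indep: "f_ideal_independent P \<tau> q" and rq: "r \<preceq> q"
    and sub: "\<And>B. B \<in> \<I> \<Longrightarrow> fMem P (check P B) \<tau> r"
    and Y: "fMem P Y \<tau> r"
    and F: "finite F" "F \<subseteq> \<I>" "C \<subseteq>\<^sup>* \<Union>F"
    and YC: "\<And>k s. s \<preceq> r \<Longrightarrow> fmem P k Y s \<Longrightarrow> k \<in> C"
  shows "fMem P Y (check_family P \<I>) r"
proof -
  obtain n :: nat and B where B: "F = B ` {..<n}"
    using finite_imp_nat_seg_image_inj_on[OF F(1)] by (auto simp: lessThan_def)
  obtain m where m: "C - \<Union>F \<subseteq> {..<m}"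
    using F(3) unfolding almost_subset_def finite_nat_iff_bounded ..
  have "f_almost_covered P Y n (\<lambda>i. check P (B i)) r"
    unfolding f_almost_covered_iff
  proof (rule dense_belowI, intro exI[of _ m] allI impI, elim conjE)
    fix s k t assume s: "s \<preceq> r" and k: "m \<le> k" and t: "t \<preceq> s" and "fmem P k Y t"
    then have "k \<in> C" using YC[OF le_trans[OF t s]] by simp
    then have "k \<in> \<Union>F" using m k by auto
    then obtain i where "i < n" "k \<in> B i" by (auto simp: B)
    then have "\<exists>i<n. fmem P k (check P (B i)) u" if "u \<preceq> t" for u
      by (intro exI[of _ i]) (simp add: fmem_check[OF FieldI1[OF that]])
    then show "dense_below P (\<lambda>t. \<exists>i<n. fmem P k (check P (B i)) t) t" by (rule dense_belowI)
  qed
  moreover have "\<forall>i<n. fMem P (check P (B i)) \<tau> r" using sub F(2) by (auto simp: B)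
  ultimately have "dense_below P (\<lambda>s. \<exists>i<n. feq P (check P (B i)) Y s) r"
    using indep rq Y unfolding f_ideal_independent_iff by simp
  then show ?thesis
    unfolding fMem_check_family
  proof (rule dense_below_mono, elim exE conjE)
    fix s i assume "i < n" "feq P (check P (B i)) Y s"
    then show "\<exists>A. A \<in> \<I> \<and> feq P Y (check P A) s"
      using F(2) by (intro exI[of _ "B i"]) (auto simp: B feq_iff)
  qed
qed

lemma fMem_check_family_if_f_ideal_independent:
  assumes "proper P" and "omega_omega_bounding P" and pres: "preserves_p_points P"
    and "p_point \<U>" and max: "maximal_ideal_independent \<I>" and "encompassing \<U> \<I>"
    and pp: "\<And>A. A \<in> \<I> \<Longrightarrow> p_point (complemented_filter \<I> A)"
    and indep: "f_ideal_independent P \<tau> q" and rq: "r \<preceq> q"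
    and sub: "\<And>B. B \<in> \<I> \<Longrightarrow> fMem P (check P B) \<tau> r"
    and Y: "fMem P Y \<tau> r"
  shows "fMem P Y (check_family P \<I>) r"
proof (rule fMem_dense, rule ccontr)
  assume "\<not> dense_below P (fMem P Y (check_family P \<I>)) r"
  \<comment> \<open>No condition below \<open>r1\<close> forces \<open>Y\<close> into
    \<open>\<I>\<close>, so reaching a single one that does gives the contradiction.\<close>
  then obtain r1 where r1: "r1 \<preceq> r" and no: "\<And>s. s \<preceq> r1 \<Longrightarrow> \<not> fMem P Y (check_family P \<I>) s"
    unfolding dense_below_def by blast
  have sub1: "fMem P (check P B) \<tau> s" if "s \<preceq> r1" "B \<in> \<I>" for s B
    using sub[OF that(2)] le_trans[OF that(1) r1] by (rule fMem_le)
  have Y1: "fMem P Y \<tau> s" if "s \<preceq> r1" for s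
    using Y le_trans[OF that r1] by (rule fMem_le)
  have r1q: "s \<preceq> q" if "s \<preceq> r1" for s
    using le_trans[OF that le_trans[OF r1 rq]] .
  have r1F: "r1 \<in> Field P" using r1 by (rule FieldI1)
  have pos: False if "s \<preceq> r1" "A \<in> \<I>" "X \<in> complemented_filter \<I> A" "\<forall>k\<in>X. fmem P k Y s" for s A X
    using fMem_check_family_if_complemented[OF indep r1q[OF that(1)]
        sub1[OF that(1)] Y1[OF that(1)] that(2,3)] that(4) no[OF that(1)] by blast
  have neg: "dense_below P (\<lambda>s. \<exists>X\<in>complemented_filter \<I> A. \<forall>k\<in>X. fneg P (fmem P k Y) s) r1"
    if "A \<in> \<I>" for A
    using p_point_decides[OF pres pp[OF that] r1F]
  proof (rule dense_below_mono, elim disjE)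
    fix s assume "s \<preceq> r1" "\<exists>X\<in>complemented_filter \<I> A. \<forall>k\<in>X. fmem P k Y s"
    then show "\<exists>X\<in>complemented_filter \<I> A. \<forall>k\<in>X. fneg P (fmem P k Y) s"
      using pos \<open>A \<in> \<I>\<close> by blast
  qed
  have "\<exists>s X. s \<preceq> r1 \<and> countable {A \<in> \<I>. X \<notin> complemented_filter \<I> A} \<and>
      (\<forall>k\<in>X. fneg P (fmem P k Y) s)"
  proof (cases "countable \<I>")
    case True
    then have "countable {A \<in> \<I>. {} \<notin> complemented_filter \<I> A}" by (rule countable_subset[rotated]) auto
    then show ?thesis using le_refl[OF r1F] by blast
  next
    case False
    obtain s where s: "s \<preceq> r1" and "(\<exists>X\<in>\<U>. \<forall>k\<in>X. fmem P k Y s) \<or>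
        (\<exists>X\<in>\<U>. \<forall>k\<in>X. fneg P (fmem P k Y) s)"
      using p_point_decides[OF pres \<open>p_point \<U>\<close> r1F] le_refl[OF r1F] by (rule dense_belowE)
    then obtain X where X: "X \<in> \<U>"
      and XY: "(\<forall>k\<in>X. fmem P k Y s) \<or> (\<forall>k\<in>X. fneg P (fmem P k Y) s)" by blast
    have "{A \<in> \<I>. X \<notin> complemented_filter \<I> A} = \<I> - {A \<in> \<I>. X \<in> complemented_filter \<I> A}"
      by auto
    then have count: "countable {A \<in> \<I>. X \<notin> complemented_filter \<I> A}"
      using \<open>encompassing \<U> \<I>\<close> X by (simp add: encompassing_def)
    \<comment> \<open>As \<open>\<I>\<close> is uncountable, \<open>X\<close> lies in some
      \<open>complemented_filter \<I> A\<close>. Hence \<open>X\<close> cannot be contained in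
      \<open>Y\<close>, and the other alternative holds.\<close>
    then have "{A \<in> \<I>. X \<notin> complemented_filter \<I> A} \<noteq> \<I>" using False by auto
    then obtain A where "A \<in> \<I>" "X \<in> complemented_filter \<I> A" by auto
    then have "\<not> (\<forall>k\<in>X. fmem P k Y s)" using pos[OF s] by blast
    then show ?thesis using XY s count by blast
  qed
  then obtain r2 X where r2: "r2 \<preceq> r1" and count: "countable {A \<in> \<I>. X \<notin> complemented_filter \<I> A}"
    and XY: "\<And>k. k \<in> X \<Longrightarrow> fneg P (fmem P k Y) r2" by blast
  define J where "J = {A \<in> \<I>. X \<notin> complemented_filter \<I> A}"
  define e where "e = from_nat_into J"
  \<comment> \<open>The guard \<open>e n \<in> J\<close> covers empty \<open>J\<close>, for which
    \<open>from_nat_into\<close> gives an arbitrary value.\<close>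
  define D where "D n F s \<longleftrightarrow> (e n \<in> J \<longrightarrow> finite F \<and> F \<subseteq> \<I> \<and> e n \<notin> F \<and>
    (\<forall>k\<in>e n - \<Union>F. fneg P (fmem P k Y) s))" for n F s
  have "downward_closed (D n F)" for n F
    by (auto simp: downward_closed_def D_def intro: fneg_le)
  moreover have "dense_below P (\<lambda>s. \<exists>F. D n F s) r2" for n
  proof (cases "e n \<in> J")
    case True
    then have "e n \<in> \<I>" by (simp add: J_def)
    then have "dense_below P (\<lambda>s. \<exists>X\<in>complemented_filter \<I> (e n). \<forall>k\<in>X. fneg P (fmem P k Y) s) r2"
      using neg dense_below_le[OF _ r2] by blast
    then show ?thesis
    proof (rule dense_below_mono, elim bexE)
      fix s V assume "V \<in> complemented_filter \<I> (e n)" and V: "\<forall>k\<in>V. fneg P (fmem P k Y) s"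
      then obtain F where "finite F" "F \<subseteq> \<I>" "e n \<notin> F" "e n - \<Union>F \<subseteq> V"
        by (elim complemented_filterE)
      then show "\<exists>F. D n F s" using V by (intro exI[of _ F]) (auto simp: D_def)
    qed
  next
    case False
    then show ?thesis by (intro dense_belowI) (simp add: D_def)
  qed
  ultimately obtain r3 H where r3: "r3 \<preceq> r2" and fin: "\<And>n. finite (H n)"
    and cover: "\<And>n. dense_below P (\<lambda>t. \<exists>F\<in>H n. D n F t) r3"
    using proper_bounding_finite_cover[OF assms(1,2) FieldI1[OF r2], of D] by blast
  \<comment> \<open>Which candidate is correct depends on the generic filter. Removing all
    admissible ones shrinks \<open>e n - \<Union>F\<close> to a ground-model set still disjoint from
    \<open>Y\<close>, while \<open>G n\<close> remains finite, inside \<open>\<I>\<close> and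
    without \<open>e n\<close>.\<close>
  define G where "G n = \<Union>{F \<in> H n. finite F \<and> F \<subseteq> \<I> \<and> e n \<notin> F}" for n
  have G: "finite (G n)" "G n \<subseteq> \<I>" "e n \<notin> G n" for n
    unfolding G_def using fin[of n] by auto
  define V where "V = X \<union> (\<Union>n\<in>{n. e n \<in> J}. e n - \<Union>(G n))"
  \<comment> \<open>\<open>V\<close> lies in every complemented filter: through
    \<open>e n - \<Union>(G n)\<close> for members of \<open>J\<close>, and through \<open>X\<close>
    for the others.\<close>
  have "- V \<notin> complemented_filter \<I> A" if A: "A \<in> \<I>" for A
  proof
    have uf: "ultrafilter_on_nat (complemented_filter \<I> A)"
      using pp[OF A] by (simp add: p_point_def)
    have "V \<in> complemented_filter \<I> A"
    proof (cases "A \<in> J")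
      case True
      moreover have "countable J" using count by (simp add: J_def)
      ultimately obtain n where n: "e n = A" unfolding e_def by (metis from_nat_into_surj)
      have "e n - \<Union>(G n) \<subseteq> V" using True n by (auto simp: V_def)
      then have "V \<in> complemented_filter \<I> (e n)" by (rule complemented_filterI[OF G])
      then show ?thesis by (simp only: n)
    next
      case False
      then have "X \<in> complemented_filter \<I> A" using A by (simp add: J_def)
      then show ?thesis by (rule ultrafilter_mono[OF uf]) (simp add: V_def)
    qed
    moreover assume "- V \<in> complemented_filter \<I> A"
    ultimately have "V \<inter> - V \<in> complemented_filter \<I> A" by (rule ultrafilter_Int[OF uf])
    then show False using uf by (simp add: ultrafilter_on_nat_def)
  qed
  then obtain F where F: "finite F" "F \<subseteq> \<I>" "- V \<subseteq>\<^sup>* \<Union>F"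
    using almost_covered_if_not_in_complemented_filters[OF max pp] by blast
  have YV: "k \<in> - V" if s: "s \<preceq> r3" and k: "fmem P k Y s" for k s
  proof
    assume "k \<in> V"
    then consider "k \<in> X" | n where "e n \<in> J" "k \<in> e n" "k \<notin> \<Union>(G n)" by (auto simp: V_def)
    then show False
    proof cases
      case 1
      then show False using fnegD[OF XY le_trans[OF s r3]] k by blast
    next
      case 2
      \<comment> \<open>Strengthening to \<open>t\<close> selects the candidate \<open>F\<close>
        that is correct there, and \<open>F \<subseteq> G n\<close>.\<close>
      obtain t F where t: "t \<preceq> s" and F: "F \<in> H n" "D n F t"
        using cover[of n] s by (elim dense_belowE) auto
      then have "F \<subseteq> G n" using 2(1) by (auto simp: G_def D_def)
      then have "k \<in> e n - \<Union>F" using 2 by blast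
      then have "fneg P (fmem P k Y) t" using F(2) 2(1) by (simp add: D_def)
      then show False using fnegD[OF _ le_refl_left[OF t]] fmem_le[OF k t] by blast
    qed
  qed
  have r31: "r3 \<preceq> r1" using r3 r2 by (rule le_trans)
  have "fMem P Y (check_family P \<I>) r3"
    by (rule fMem_check_family_if_almost_covered[OF indep r1q[OF r31] sub1[OF r31] Y1[OF r31] F YV])
  then show False using no[OF r31] by contradiction
qed

end

section \<open>Maximality in every generic extension\<close>

theorem mainTheorem7:
  fixes P :: "'p rel" and \<U> \<I> :: "nat set set"
  assumes "p_point \<U>"
    and "forcing_notion P"
    and "proper P"
    and "omega_omega_bounding P"
    and "preserves_p_points P"
    and "maximal_ideal_independent \<I>"
    and "encompassing \<U> \<I>"
    and "\<forall>A\<in>\<I>. p_point (complemented_filter \<I> A)"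
  shows "forced P (f_maximal_ideal_independent P (check_family P \<I>))"
proof -
  interpret forcing P using assms(2) by unfold_locales (simp add: forcing_notion_def)
  have ii: "ideal_independent \<I>" using assms(6) by (simp add: maximal_ideal_independent_def)
  have pp: "p_point (complemented_filter \<I> A)" if "A \<in> \<I>" for A using assms(8) that by blast
  \<comment> \<open>This is the substantial half of maximality; the reverse inclusion is the
    assumption that \<open>\<tau>\<close> extends \<open>\<I>\<close>.\<close>
  have mem: "fMem P X (check_family P \<I>) r"
    if indep: "f_ideal_independent P \<tau> q"
      and sub: "\<forall>X r. r \<preceq> q \<and> fMem P X (check_family P \<I>) r \<longrightarrow> fMem P X \<tau> r"
      and r: "r \<preceq> q" and X: "fMem P X \<tau> r" for X \<tau> q r
  proof (rule fMem_check_family_if_f_ideal_independent[OF assms(3,4,5,1,6,7) pp indep r _ X])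
    show "fMem P (check P B) \<tau> r" if "B \<in> \<I>" for B using sub r fMem_check[OF that] by blast
  qed
  show ?thesis
    unfolding forced_def f_maximal_ideal_independent_def fconj_def fall_def fimp_def fiff_def
  proof (intro ballI conjI allI impI; (elim conjE)?)
    show "f_ideal_independent P (check_family P \<I>) p" for p
      using ii by (rule f_ideal_independent_check_family)
  next
    fix q \<tau> X r
    assume "f_ideal_independent P \<tau> q" and "r \<preceq> q" "fMem P X \<tau> r"
      and "\<forall>X\<in>UNIV. \<forall>r. r \<preceq> q \<and> fMem P X (check_family P \<I>) r \<longrightarrow> fMem P X \<tau> r"
    then show "fMem P X (check_family P \<I>) r" by (intro mem[of \<tau> q]) simp_all
  qed simp
qed

end
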